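(* Let $$\widetilde K=\begin{pmatrix}\widetilde A&\widetilde B^T&\widetilde E^T\\-\widetilde B&\widetilde D&\widetilde C^T\\\widetilde E&-\widetilde C&\widetilde F\end{pmatrix}$$ be a real block matrix (with square diagonal blocks). Suppose that $\widetilde A$ is symmetric positive definite, $\widetilde D$ is symmetric, and $\widetilde F-\widetilde E\widetilde A^{-1}\widetilde E^T$ is symmetric positive semi-definite. Write $s=\lambda_{\max}(\widetilde E\widetilde A^{-2}\widetilde E^T)$. Then every eigenvalue $\lambda(\widetilde K)$ of $\widetilde K$ satisfies $$\mathrm{Re}(\lambda(\widetilde K))\ge\min\Big\{\lambda_{\min}(\widetilde A),\ \lambda_{\min}(\widetilde F-\widetilde E\widetilde A^{-1}\widetilde E^T),\ \frac{\lambda_{\min}(\widetilde D)}{g_1(s)}\Big\}\,g_1(s),$$ $$\mathrm{Re}(\lambda(\widetilde K))\le\max\Big\{\lambda_{\max}(\widetilde A),\ \lambda_{\max}(\widetilde F-\widetilde E\widetilde A^{-1}\widetilde E^T),\ \frac{\lambda_{\max}(\widetilde D)}{g_2(s)}\Big\}\,g_2(s),$$ and $$|\mathrm{Im}(\lambda(\widetilde K))|\le\sqrt{\lambda_{\max}(\widetilde B\widetilde B^T+\widetilde C^T\widetilde C)}.$$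
   Context: $\lambda_{\min}(\cdot)$ and $\lambda_{\max}(\cdot)$ denote the minimum and maximum eigenvalues of a real symmetric matrix. The functions $g_1,g_2$ are the positive functions on $[0,+\infty)$ defined by $$g_1(s)=1+\tfrac12 s-\sqrt{\tfrac14s^2+s},\qquad g_2(s)=1+\tfrac12 s+\sqrt{\tfrac14s^2+s}.$$ *)

theory Defs
  imports "HOL-Analysis.Analysis"
begin

definition eigenvalues :: "'a::field^'n^'n \<Rightarrow> 'a set" where
  "eigenvalues A = {k. \<exists>v. v \<noteq> 0 \<and> A *v v = k *s v}"

text \<open>
  For a real symmetric matrix the set of real eigenvalues is finite and nonempty, so the minimum
  and maximum below are attained.  They are only meaningful for symmetric arguments.
\<close>

definition lambda_min :: "real^'n^'n \<Rightarrow> real" where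
  "lambda_min A = Min (eigenvalues A)"

definition lambda_max :: "real^'n^'n \<Rightarrow> real" where
  "lambda_max A = Max (eigenvalues A)"

definition symmetric_mat :: "real^'n^'n \<Rightarrow> bool" where
  "symmetric_mat A \<longleftrightarrow> transpose A = A"

definition spd :: "real^'n^'n \<Rightarrow> bool" where
  "spd A \<longleftrightarrow> symmetric_mat A \<and> (\<forall>x. x \<noteq> 0 \<longrightarrow> 0 < x \<bullet> (A *v x))"

definition spsd :: "real^'n^'n \<Rightarrow> bool" where
  "spsd A \<longleftrightarrow> symmetric_mat A \<and> (\<forall>x. 0 \<le> x \<bullet> (A *v x))"

text \<open>
  Rows and columns of a 3-by-3 block matrix are indexed by the sum of the three block index types;
  the arguments are the blocks in row-major order.
\<close>

definition block3 ::
  "'a^'n^'n \<Rightarrow> 'a^'m^'n \<Rightarrow> 'a^'l^'n \<Rightarrow>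
   'a^'n^'m \<Rightarrow> 'a^'m^'m \<Rightarrow> 'a^'l^'m \<Rightarrow>
   'a^'n^'l \<Rightarrow> 'a^'m^'l \<Rightarrow> 'a^'l^'l \<Rightarrow>
   'a^('n + 'm + 'l)^('n + 'm + 'l)" where
  "block3 K11 K12 K13 K21 K22 K23 K31 K32 K33 = (\<chi> i j.
     case i of
       Inl a \<Rightarrow> (case j of Inl b \<Rightarrow> K11 $ a $ b | Inr (Inl b) \<Rightarrow> K12 $ a $ b | Inr (Inr b) \<Rightarrow> K13 $ a $ b)
     | Inr (Inl a) \<Rightarrow> (case j of Inl b \<Rightarrow> K21 $ a $ b | Inr (Inl b) \<Rightarrow> K22 $ a $ b | Inr (Inr b) \<Rightarrow> K23 $ a $ b)
     | Inr (Inr a) \<Rightarrow> (case j of Inl b \<Rightarrow> K31 $ a $ b | Inr (Inl b) \<Rightarrow> K32 $ a $ b | Inr (Inr b) \<Rightarrow> K33 $ a $ b))"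

text \<open>Both functions are intended for nonnegative arguments.\<close>

definition g1 :: "real \<Rightarrow> real" where
  "g1 s = 1 + s / 2 - sqrt (s^2 / 4 + s)"

definition g2 :: "real \<Rightarrow> real" where
  "g2 s = 1 + s / 2 + sqrt (s^2 / 4 + s)"

end

theory Submission
  imports Defs
begin

text \<open>
  Let \<open>v = p + i q\<close> be an eigenvector with \<open>p\<close>, \<open>q\<close> real. Pairing \<open>K v = k v\<close> with the
  conjugate of \<open>v\<close> gives \<open>Re k\<close> as a weighted mean of the Rayleigh quotients of \<open>K\<close> at \<open>p\<close> and
  \<open>q\<close>, and \<open>Im k |v|\<^sup>2\<close> as \<open>p \<bullet> K q - q \<bullet> K p\<close>, which only sees the skew part of \<open>K\<close>
  (\<open>complex_eigenvalue_real_forms\<close>). Everything else is about real forms.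

  For the real part, \<open>B\<close> and \<open>C\<close> cancel from \<open>v \<bullet> K v\<close>, leaving \<open>y \<bullet> D y\<close> plus the form of the
  symmetric matrix with blocks \<open>A\<close>, \<open>E\<^sup>T\<close>, \<open>E\<close>, \<open>F\<close>. Completing the square turns the latter into
  \<open>w \<bullet> A w + z \<bullet> S z\<close> with \<open>w = x + A\<^sup>-\<^sup>1 E\<^sup>T z\<close> (\<open>schur_complement_square\<close>), which lies between
  the extreme eigenvalues of \<open>A\<close> and \<open>S\<close> times \<open>|w|\<^sup>2 + |z|\<^sup>2\<close>. It remains to compare this with
  \<open>|x|\<^sup>2 + |z|\<^sup>2\<close>: the shear \<open>(x, z) \<mapsto> (w, z)\<close> has a part \<open>z \<mapsto> A\<^sup>-\<^sup>1 E\<^sup>T z\<close> whose squared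
  operator norm is \<open>s\<close>, and \<open>g1 s\<close>, \<open>g2 s\<close> are the extreme factors by which such a shear can change
  a squared length (\<open>shear_bounds\<close>). Since \<open>A\<close> and \<open>S\<close> are semidefinite, the factors may be
  multiplied (\<open>schur_form_bounds\<close>). The block \<open>D\<close> is not sheared, hence the compensating
  denominators below its eigenvalues.

  For the imaginary part only \<open>B\<close> and \<open>C\<close> survive. They pair the middle block with the two outer
  ones through \<open>y \<mapsto> (B\<^sup>T y, - C y)\<close>, whose squared operator norm is the largest eigenvalue of
  \<open>B B\<^sup>T + C\<^sup>T C\<close>; the inequality between arithmetic and geometric means then gives the bound
  (\<open>skew_form_bound\<close>).
\<close>

section \<open>Rayleigh quotients of a symmetric matrix\<close>

lemma inner_transpose_mult:
  fixes M :: "real^'n^'m"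
  shows "x \<bullet> (transpose M *v y) = (M *v x) \<bullet> y"
  by (metis dot_lmul_matrix inner_commute transpose_matrix_vector)

lemma symmetric_mat_inner:
  assumes "symmetric_mat M"
  shows "x \<bullet> (M *v y) = (M *v x) \<bullet> y"
  using assms inner_transpose_mult[of x M y] by (simp only: symmetric_mat_def)

lemma symmetric_mat_uminus: "symmetric_mat M \<Longrightarrow> symmetric_mat (- M)"
  by (simp add: symmetric_mat_def transpose_def vec_eq_iff)

lemma uminus_matrix_vector_mult:
  fixes M :: "'a::ring_1^'n^'m"
  shows "(- M) *v x = - (M *v x)"
  by (simp add: vec_eq_iff matrix_vector_mult_def sum_negf)

lemma eigenvalues_uminus: "eigenvalues (- M) = uminus ` eigenvalues (M :: real^'n^'n)"
proof -
  have "- (M *v v) = k *\<^sub>R v \<longleftrightarrow> M *v v = (- k) *\<^sub>R v" for k v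
    by (metis minus_minus scaleR_minus_left)
  then have iff: "k \<in> eigenvalues (- M) \<longleftrightarrow> - k \<in> eigenvalues M" for k
    by (simp only: eigenvalues_def mem_Collect_eq uminus_matrix_vector_mult scalar_mult_eq_scaleR)
  show ?thesis
  proof (rule set_eqI)
    show "k \<in> eigenvalues (- M) \<longleftrightarrow> k \<in> uminus ` eigenvalues M" for k
      unfolding iff by (metis imageE image_eqI minus_minus)
  qed
qed

text \<open>
  Eigenvectors for distinct eigenvalues are orthogonal, hence independent. Finiteness is what makes
  the \<open>Min\<close> and \<open>Max\<close> of the set of eigenvalues meaningful.
\<close>

lemma eigenvalues_finite:
  assumes sym: "symmetric_mat (M :: real^'n^'n)"
  shows "finite (eigenvalues M)"
proof -
  obtain v where v: "v k \<noteq> 0" "M *v v k = k *\<^sub>R v k" if "k \<in> eigenvalues M" for k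
  proof -
    have "\<forall>k\<in>eigenvalues M. \<exists>v. v \<noteq> 0 \<and> M *v v = k *\<^sub>R v"
      by (simp add: eigenvalues_def scalar_mult_eq_scaleR)
    then show ?thesis using that by (metis bchoice)
  qed
  have orth: "orthogonal (v k) (v l)"
    if "k \<in> eigenvalues M" "l \<in> eigenvalues M" "k \<noteq> l" for k l
    using symmetric_mat_inner[OF sym, of "v k" "v l"] v that
    by (simp add: orthogonal_def)
  have inj: "inj_on v (eigenvalues M)"
    by (rule inj_onI) (metis orth orthogonal_self v(1))
  have "independent (v ` eigenvalues M)"
  proof (rule pairwise_orthogonal_independent)
    show "pairwise orthogonal (v ` eigenvalues M)"
      using orth by (auto simp: pairwise_def)
    show "0 \<notin> v ` eigenvalues M"
      using v(1) by (metis imageE)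
  qed
  then show ?thesis
    using inj independent_bound finite_imageD by blast
qed

text \<open>
  By compactness the form attains its maximum \<open>k\<close> over the unit sphere at some \<open>u\<close>. The form of
  \<open>k - M\<close> is then nonnegative and vanishes at \<open>u\<close>, so its first variation at \<open>u\<close> is zero; testing
  it in the direction of the residual \<open>w = k u - M u\<close> gives \<open>w = 0\<close>.
\<close>

lemma rayleigh_max_eigenvalue:
  assumes sym: "symmetric_mat (M :: real^'n^'n)"
  obtains k where "k \<in> eigenvalues M" "\<And>x. x \<bullet> (M *v x) \<le> k * (x \<bullet> x)"
proof -
  have "continuous_on (sphere 0 1) (\<lambda>x. x \<bullet> (M *v x))"
    by (intro continuous_intros)
  then obtain u where u: "norm u = 1" and max: "\<And>y. norm y = 1 \<Longrightarrow> y \<bullet> (M *v y) \<le> u \<bullet> (M *v u)"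
    using continuous_attains_sup[of "sphere 0 1" "\<lambda>x. x \<bullet> (M *v x)"] compact_sphere
    by (auto simp: dist_norm)
  define k where "k = u \<bullet> (M *v u)"
  have bound: "x \<bullet> (M *v x) \<le> k * (x \<bullet> x)" for x
  proof (cases "x = 0")
    case False
    define c where "c = inverse (norm x)"
    have c: "c > 0" "c\<^sup>2 * (x \<bullet> x) = 1"
      using False by (auto simp: c_def dot_square_norm power_inverse)
    have "c\<^sup>2 * (x \<bullet> (M *v x)) \<le> k"
      using max[of "c *\<^sub>R x"] False
      by (simp add: k_def c_def matrix_vector_mult_scaleR power2_eq_square mult.assoc)
    then have "c\<^sup>2 * (x \<bullet> (M *v x)) \<le> c\<^sup>2 * (k * (x \<bullet> x))"
      using c(2) by (simp add: algebra_simps)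
    then show ?thesis using c(1) by simp
  qed simp
  define w where "w = k *\<^sub>R u - M *v u"
  define d where "d = k * (w \<bullet> w) - w \<bullet> (M *v w)"
  have uu: "u \<bullet> u = 1" using u by (simp add: dot_square_norm)
  have pos: "0 \<le> 2 * t * (w \<bullet> w) + t\<^sup>2 * d" for t
  proof -
    have "0 \<le> k * ((u + t *\<^sub>R w) \<bullet> (u + t *\<^sub>R w)) - (u + t *\<^sub>R w) \<bullet> (M *v (u + t *\<^sub>R w))"
      using bound[of "u + t *\<^sub>R w"] by simp
    also have "\<dots> = 2 * t * (w \<bullet> (k *\<^sub>R u - M *v u)) + t\<^sup>2 * d"
      using symmetric_mat_inner[OF sym, of u w] uu
      by (simp add: d_def k_def[symmetric] matrix_vector_right_distrib matrix_vector_mult_scaleR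
          inner_simps inner_commute power2_eq_square algebra_simps)
    finally show ?thesis by (simp add: w_def)
  qed
  have "w \<bullet> w = 0"
  proof (rule ccontr)
    assume "w \<bullet> w \<noteq> 0"
    then have ww: "w \<bullet> w > 0" by simp
    \<comment> \<open>A negative step so short that the linear term of \<open>pos\<close> outweighs the quadratic one.\<close>
    define t where "t = - (w \<bullet> w) / (\<bar>d\<bar> + 1)"
    have "t < 0" using ww by (simp add: t_def)
    have "0 \<le> t * (2 * (w \<bullet> w) + t * d)"
      using pos[of t] by (simp add: algebra_simps power2_eq_square)
    then have "2 * (w \<bullet> w) + t * d \<le> 0"
      using \<open>t < 0\<close> by (simp add: zero_le_mult_iff)
    moreover have "\<bar>t * d\<bar> \<le> w \<bullet> w"
      using ww by (simp add: t_def abs_mult field_simps)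
    ultimately show False using ww by linarith
  qed
  then have "M *v u = k *\<^sub>R u" by (simp add: w_def)
  moreover have "u \<noteq> 0" using u by auto
  ultimately have "k \<in> eigenvalues M"
    by (auto simp: eigenvalues_def scalar_mult_eq_scaleR)
  with bound show ?thesis using that by blast
qed

lemma rayleigh_le_lambda_max:
  assumes "symmetric_mat M"
  shows "x \<bullet> (M *v x) \<le> lambda_max M * (x \<bullet> x)"
proof -
  obtain k where k: "k \<in> eigenvalues M" "\<And>x. x \<bullet> (M *v x) \<le> k * (x \<bullet> x)"
    using rayleigh_max_eigenvalue[OF assms] by blast
  have "k \<le> lambda_max M"
    using k(1) eigenvalues_finite[OF assms] by (simp add: lambda_max_def)
  then have "k * (x \<bullet> x) \<le> lambda_max M * (x \<bullet> x)"
    by (intro mult_right_mono) auto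
  with k(2) show ?thesis using order_trans by blast
qed

lemma lambda_max_uminus:
  assumes "symmetric_mat M"
  shows "lambda_max (- M) = - lambda_min M"
proof -
  have "eigenvalues M \<noteq> {}"
    by (metis rayleigh_max_eigenvalue[OF assms] empty_iff)
  then show ?thesis
    using eigenvalues_finite[OF assms]
    by (simp add: lambda_max_def lambda_min_def eigenvalues_uminus)
qed

lemma lambda_min_le_rayleigh:
  assumes "symmetric_mat M"
  shows "lambda_min M * (x \<bullet> x) \<le> x \<bullet> (M *v x)"
  using rayleigh_le_lambda_max[OF symmetric_mat_uminus[OF assms], of x]
  by (simp add: lambda_max_uminus[OF assms] uminus_matrix_vector_mult)

lemma lambda_min_attained:
  assumes "symmetric_mat (M :: real^'n^'n)"
  shows "lambda_min M \<in> eigenvalues M"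
  using rayleigh_max_eigenvalue[OF assms] eigenvalues_finite[OF assms]
  unfolding lambda_min_def by (metis Min_in empty_iff)

lemma eigenvalue_nonneg:
  assumes "\<And>x. 0 \<le> x \<bullet> (M *v x)" and "k \<in> eigenvalues (M :: real^'n^'n)"
  shows "0 \<le> k"
proof -
  obtain v where v: "v \<noteq> 0" "M *v v = k *\<^sub>R v"
    using assms(2) by (auto simp: eigenvalues_def scalar_mult_eq_scaleR)
  then have "0 \<le> k * (v \<bullet> v)" using assms(1)[of v] by simp
  moreover have "0 < v \<bullet> v" using v(1) by simp
  ultimately show ?thesis by (simp add: zero_le_mult_iff del: inner_gt_zero_iff)
qed

lemma lambda_max_nonneg:
  assumes "symmetric_mat M" and "\<And>x. 0 \<le> x \<bullet> (M *v x)"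
  shows "0 \<le> lambda_max M"
  using rayleigh_max_eigenvalue[OF assms(1)] eigenvalues_finite[OF assms(1)]
    eigenvalue_nonneg[OF assms(2)]
  by (metis Max_ge lambda_max_def order_trans)

section \<open>The extremal stretch factors of a shear\<close>

text \<open>
  The condition \<open>(g - 1)\<^sup>2 = s g\<close> is the characteristic equation of the squared lengths under a
  shear of squared norm \<open>s\<close>; \<open>g1 s\<close> and \<open>g2 s\<close> are its two roots. For \<open>g > 0\<close>
  the right-hand side is nonnegative once \<open>|u|\<^sup>2 \<le> s |z|\<^sup>2\<close>, so the sign of \<open>g - 1\<close> decides on which side the
  stretched length is bounded, and one identity yields both estimates.
\<close>

lemma shear_identity:
  fixes x u :: "'a::real_inner" and z :: "'b::real_inner"
  assumes "(g - 1)\<^sup>2 = s * g"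
  shows "(g - 1) * (g * (x \<bullet> x + z \<bullet> z) - ((x + u) \<bullet> (x + u) + z \<bullet> z))
    = ((g - 1) *\<^sub>R x - u) \<bullet> ((g - 1) *\<^sub>R x - u) + g * (s * (z \<bullet> z) - u \<bullet> u)"
proof -
  have "(g - 1) * (g * (x \<bullet> x + z \<bullet> z) - ((x + u) \<bullet> (x + u) + z \<bullet> z))
    = (g - 1)\<^sup>2 * (x \<bullet> x) - 2 * (g - 1) * (x \<bullet> u) + u \<bullet> u + (g - 1)\<^sup>2 * (z \<bullet> z) - g * (u \<bullet> u)"
    by (simp add: inner_simps inner_commute power2_eq_square algebra_simps)
  also have "(g - 1)\<^sup>2 * (z \<bullet> z) = g * (s * (z \<bullet> z))"
    unfolding assms by simp
  also have "(g - 1)\<^sup>2 * (x \<bullet> x) - 2 * (g - 1) * (x \<bullet> u) + u \<bullet> u + g * (s * (z \<bullet> z)) - g * (u \<bullet> u)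
    = ((g - 1) *\<^sub>R x - u) \<bullet> ((g - 1) *\<^sub>R x - u) + g * (s * (z \<bullet> z) - u \<bullet> u)"
    by (simp add: inner_simps inner_commute power2_eq_square algebra_simps)
  finally show ?thesis .
qed

lemma g1_g2_facts:
  assumes "0 \<le> s"
  shows "(g1 s - 1)\<^sup>2 = s * g1 s" "(g2 s - 1)\<^sup>2 = s * g2 s"
    "0 < g1 s" "0 < g2 s" "0 < s \<Longrightarrow> g1 s < 1" "0 < s \<Longrightarrow> 1 < g2 s"
proof -
  define r where "r = sqrt (s\<^sup>2 / 4 + s)"
  have r: "r\<^sup>2 = s\<^sup>2 / 4 + s" "0 \<le> r" using assms by (auto simp: r_def)
  have g: "g1 s = 1 + s / 2 - r" "g2 s = 1 + s / 2 + r" by (auto simp: g1_def g2_def r_def)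
  show "(g1 s - 1)\<^sup>2 = s * g1 s" "(g2 s - 1)\<^sup>2 = s * g2 s"
    using r(1) unfolding g by (simp_all add: power2_eq_square field_simps)
  show "0 < g2 s" using assms r g by simp
  have "r\<^sup>2 < (1 + s / 2)\<^sup>2" using r by (simp add: power2_eq_square field_simps)
  then have "r < 1 + s / 2" using assms power_less_imp_less_base by fastforce
  then show "0 < g1 s" using g by simp
  show "g1 s < 1" "1 < g2 s" if "0 < s"
  proof -
    have "(s / 2)\<^sup>2 < r\<^sup>2" using r that by (simp add: power2_eq_square field_simps)
    then have "s / 2 < r" using r(2) power_less_imp_less_base by blast
    then show "g1 s < 1" "1 < g2 s" using g that by auto
  qed
qed

text \<open>
  For \<open>s = 0\<close> both roots equal 1 and the factor \<open>g - 1\<close> of the identity cannot be cancelled, but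
  then \<open>u = 0\<close> and nothing is stretched.
\<close>

lemma shear_bounds:
  fixes x u :: "'a::real_inner" and z :: "'b::real_inner"
  assumes "0 \<le> s" and u: "u \<bullet> u \<le> s * (z \<bullet> z)"
  shows "g1 s * (x \<bullet> x + z \<bullet> z) \<le> (x + u) \<bullet> (x + u) + z \<bullet> z"
    and "(x + u) \<bullet> (x + u) + z \<bullet> z \<le> g2 s * (x \<bullet> x + z \<bullet> z)"
proof -
  note g = g1_g2_facts[OF assms(1)]
  have pos: "0 \<le> (g - 1) * (g * (x \<bullet> x + z \<bullet> z) - ((x + u) \<bullet> (x + u) + z \<bullet> z))"
    if "(g - 1)\<^sup>2 = s * g" "0 < g" for g
    unfolding shear_identity[OF that(1)] using u that(2) by simp
  have "g1 s * (x \<bullet> x + z \<bullet> z) \<le> (x + u) \<bullet> (x + u) + z \<bullet> z \<and>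
    (x + u) \<bullet> (x + u) + z \<bullet> z \<le> g2 s * (x \<bullet> x + z \<bullet> z)"
  proof (cases "s = 0")
    case True
    then have "u \<bullet> u = 0" using u inner_ge_zero[of u] by simp
    with True show ?thesis by (simp add: g1_def g2_def)
  next
    case False
    then show ?thesis
      using pos[OF g(1,3)] pos[OF g(2,4)] g(5,6) assms(1) by (simp add: zero_le_mult_iff)
  qed
  then show "g1 s * (x \<bullet> x + z \<bullet> z) \<le> (x + u) \<bullet> (x + u) + z \<bullet> z"
    and "(x + u) \<bullet> (x + u) + z \<bullet> z \<le> g2 s * (x \<bullet> x + z \<bullet> z)" by auto
qed

section \<open>Block vectors\<close>

definition part1 :: "'a^('n::finite + 'm::finite + 'l::finite) \<Rightarrow> 'a^'n" where
  "part1 v = (\<chi> i. v $ Inl i)"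

definition part2 :: "'a^('n::finite + 'm::finite + 'l::finite) \<Rightarrow> 'a^'m" where
  "part2 v = (\<chi> i. v $ Inr (Inl i))"

definition part3 :: "'a^('n::finite + 'm::finite + 'l::finite) \<Rightarrow> 'a^'l" where
  "part3 v = (\<chi> i. v $ Inr (Inr i))"

lemma sum_UNIV_Plus:
  fixes f :: "'a::finite + 'b::finite \<Rightarrow> 'c::comm_monoid_add"
  shows "(\<Sum>i\<in>UNIV. f i) = (\<Sum>i\<in>UNIV. f (Inl i)) + (\<Sum>i\<in>UNIV. f (Inr i))"
  by (subst UNIV_sum, subst sum.union_disjoint) (auto simp: sum.reindex)

lemma inner_parts:
  fixes v w :: "real^('n::finite + 'm::finite + 'l::finite)"
  shows "v \<bullet> w = part1 v \<bullet> part1 w + part2 v \<bullet> part2 w + part3 v \<bullet> part3 w"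
  by (simp add: inner_vec_def part1_def part2_def part3_def sum_UNIV_Plus add.assoc)

lemma block3_mult_parts:
  fixes v :: "'a::semiring_1^('n::finite + 'm::finite + 'l::finite)"
    and K11 :: "'a^'n^'n" and K12 :: "'a^'m^'n" and K13 :: "'a^'l^'n"
    and K21 :: "'a^'n^'m" and K22 :: "'a^'m^'m" and K23 :: "'a^'l^'m"
    and K31 :: "'a^'n^'l" and K32 :: "'a^'m^'l" and K33 :: "'a^'l^'l"
  defines "K \<equiv> block3 K11 K12 K13 K21 K22 K23 K31 K32 K33"
  shows "part1 (K *v v) = K11 *v part1 v + K12 *v part2 v + K13 *v part3 v"
    and "part2 (K *v v) = K21 *v part1 v + K22 *v part2 v + K23 *v part3 v"
    and "part3 (K *v v) = K31 *v part1 v + K32 *v part2 v + K33 *v part3 v"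
  by (simp_all add: K_def block3_def part1_def part2_def part3_def vec_eq_iff
      matrix_vector_mult_def sum_UNIV_Plus add.assoc)

section \<open>Complex eigenvalues of a real matrix\<close>

text \<open>
  With the eigenvector \<open>p + i q\<close>, the two forms are the real and the imaginary part of
  \<open>v\<^sup>* K v = k |v|\<^sup>2\<close>.
\<close>

lemma complex_eigenvalue_real_forms:
  fixes K :: "real^'n^'n"
  assumes "k \<in> eigenvalues (map_matrix complex_of_real K)"
  obtains p q :: "real^'n" where "0 < p \<bullet> p + q \<bullet> q"
    and "p \<bullet> (K *v p) + q \<bullet> (K *v q) = Re k * (p \<bullet> p + q \<bullet> q)"
    and "p \<bullet> (K *v q) - q \<bullet> (K *v p) = Im k * (p \<bullet> p + q \<bullet> q)"
proof -
  obtain v where v: "v \<noteq> 0" "map_matrix complex_of_real K *v v = k *s v"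
    using assms by (auto simp: eigenvalues_def)
  define p where "p = (\<chi> i. Re (v $ i))"
  define q where "q = (\<chi> i. Im (v $ i))"
  have row: "(\<Sum>j\<in>UNIV. complex_of_real (K $ i $ j) * v $ j) = k * v $ i" for i
    using arg_cong[OF v(2), of "\<lambda>w. w $ i"]
    by (simp add: matrix_vector_mult_def map_matrix_def)
  have Kp: "K *v p = Re k *\<^sub>R p - Im k *\<^sub>R q"
    using arg_cong[OF row, of Re] by (simp add: vec_eq_iff matrix_vector_mult_def p_def q_def)
  have Kq: "K *v q = Re k *\<^sub>R q + Im k *\<^sub>R p"
    using arg_cong[OF row, of Im] by (simp add: vec_eq_iff matrix_vector_mult_def p_def q_def)
  have "p \<noteq> 0 \<or> q \<noteq> 0"
    using v(1) by (auto simp: p_def q_def vec_eq_iff complex_eq_iff)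
  then have "0 < p \<bullet> p + q \<bullet> q"
    by (metis add_nonneg_pos add_pos_nonneg inner_ge_zero inner_gt_zero_iff)
  moreover have "p \<bullet> (K *v p) + q \<bullet> (K *v q) = Re k * (p \<bullet> p + q \<bullet> q)"
    by (simp add: Kp Kq inner_simps inner_commute algebra_simps)
  moreover have "p \<bullet> (K *v q) - q \<bullet> (K *v p) = Im k * (p \<bullet> p + q \<bullet> q)"
    by (simp add: Kp Kq inner_simps inner_commute algebra_simps)
  ultimately show ?thesis using that by blast
qed

section \<open>The two forms of the block matrix\<close>

lemma spd_invertible:
  assumes "spd A"
  shows "invertible A"
proof -
  have "x = 0" if "A *v x = 0" for x
    using assms that by (metis inner_zero_right less_irrefl spd_def)
  then show ?thesis
    using invertible_left_inverse matrix_left_invertible_ker by blast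
qed

lemma matrix_inv_right_mult:
  assumes "invertible A"
  shows "A ** matrix_inv A = mat 1"
  using someI_ex[OF assms[unfolded invertible_def]] by (simp add: matrix_inv_def)

lemma symmetric_mat_matrix_inv:
  assumes sym: "symmetric_mat A" and inv: "invertible A"
  shows "symmetric_mat (matrix_inv A)"
proof -
  let ?X = "matrix_inv A"
  have 1: "A ** ?X = mat 1" by (rule matrix_inv_right_mult[OF inv])
  have "transpose ?X ** A = mat 1"
    using arg_cong[OF 1, of transpose] sym
    by (simp add: matrix_transpose_mul symmetric_mat_def transpose_mat)
  then show ?thesis
    by (metis 1 matrix_mul_assoc matrix_mul_lid matrix_mul_rid symmetric_mat_def)
qed

text \<open>
  This is the block factorization \<open>L diag(A, S) L\<^sup>T\<close> read as an identity of quadratic forms: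
  \<open>u\<close> solves \<open>A u = E\<^sup>T z\<close>, so the cross terms of \<open>(x + u) \<bullet> A (x + u)\<close> are those of \<open>E\<close>, and the
  surplus \<open>u \<bullet> A u\<close> is what the Schur complement subtracts from \<open>F\<close>.
\<close>

lemma schur_complement_square:
  fixes A :: "real^'n^'n" and E :: "real^'n^'l" and z :: "real^'l"
  assumes sym: "symmetric_mat A" and inv: "invertible A"
  defines "u \<equiv> matrix_inv A *v (transpose E *v z)"
  shows "(x + u) \<bullet> (A *v (x + u)) + z \<bullet> ((F - E ** matrix_inv A ** transpose E) *v z)
    = x \<bullet> (A *v x) + x \<bullet> (transpose E *v z) + z \<bullet> (E *v x) + z \<bullet> (F *v z)"
proof -
  have Au: "A *v u = transpose E *v z"
    using matrix_inv_right_mult[OF inv] 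
    by (metis u_def matrix_vector_mul_assoc matrix_vector_mul_lid)
  have xu: "x \<bullet> (A *v u) = x \<bullet> (transpose E *v z)" and ux: "u \<bullet> (A *v x) = z \<bullet> (E *v x)"
    and uu: "u \<bullet> (A *v u) = z \<bullet> (E *v u)"
    using symmetric_mat_inner[OF sym, of u x] inner_transpose_mult[of _ E z]
    by (simp_all only: Au inner_commute)
  have "(F - E ** matrix_inv A ** transpose E) *v z = F *v z - E *v u"
    by (simp only: u_def matrix_vector_mult_diff_rdistrib matrix_vector_mul_assoc matrix_mul_assoc)
  then show ?thesis
    by (simp only: matrix_vector_right_distrib inner_simps xu ux uu)
qed

text \<open>
  \<open>E A\<^sup>-\<^sup>2 E\<^sup>T\<close> is the Gram matrix of \<open>z \<mapsto> A\<^sup>-\<^sup>1 E\<^sup>T z\<close> because \<open>A\<^sup>-\<^sup>1\<close> is symmetric, so its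
  largest eigenvalue is the squared operator norm of that map.
\<close>

lemma shear_norm_le:
  fixes A :: "real^'n^'n" and E :: "real^'n^'l"
  assumes sym: "symmetric_mat A" and inv: "invertible A"
  defines "s \<equiv> lambda_max (E ** (matrix_inv A ** matrix_inv A) ** transpose E)"
  shows "0 \<le> s"
    and "(matrix_inv A *v (transpose E *v z)) \<bullet> (matrix_inv A *v (transpose E *v z)) \<le> s * (z \<bullet> z)"
proof -
  let ?X = "matrix_inv A"
  let ?G = "E ** (?X ** ?X) ** transpose E"
  have X: "transpose ?X = ?X"
    using symmetric_mat_matrix_inv[OF sym inv] by (simp add: symmetric_mat_def)
  have symG: "symmetric_mat ?G"
    by (simp add: symmetric_mat_def matrix_transpose_mul X matrix_mul_assoc)
  have form: "z \<bullet> (?G *v z) = (?X *v (transpose E *v z)) \<bullet> (?X *v (transpose E *v z))" for z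
  proof -
    have "z \<bullet> (?G *v z) = z \<bullet> (E *v (?X *v (?X *v (transpose E *v z))))"
      by (simp only: matrix_vector_mul_assoc matrix_mul_assoc)
    also have "\<dots> = (transpose E *v z) \<bullet> (?X *v (?X *v (transpose E *v z)))"
      by (metis inner_transpose_mult inner_commute)
    also have "\<dots> = (?X *v (transpose E *v z)) \<bullet> (?X *v (transpose E *v z))"
      by (rule symmetric_mat_inner[OF symmetric_mat_matrix_inv[OF sym inv]])
    finally show ?thesis .
  qed
  show "0 \<le> s"
    unfolding s_def by (rule lambda_max_nonneg[OF symG]) (simp only: form inner_ge_zero)
  show "(?X *v (transpose E *v z)) \<bullet> (?X *v (transpose E *v z)) \<le> s * (z \<bullet> z)"
    using rayleigh_le_lambda_max[OF symG, of z] by (simp only: s_def form)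
qed

text \<open>
  Semidefiniteness of \<open>A\<close> and \<open>S\<close> enters through the sign of their extreme eigenvalues: only for
  nonnegative ones may the eigenvalue bound be multiplied with the bound for the shear.
\<close>

lemma schur_form_bounds:
  fixes A :: "real^'n^'n" and E :: "real^'n^'l" and F :: "real^'l^'l"
  defines "S \<equiv> F - E ** matrix_inv A ** transpose E"
    and "s \<equiv> lambda_max (E ** (matrix_inv A ** matrix_inv A) ** transpose E)"
  assumes A: "spd A" and S: "spsd S"
  defines "form \<equiv> \<lambda>x z. x \<bullet> (A *v x) + x \<bullet> (transpose E *v z) + z \<bullet> (E *v x) + z \<bullet> (F *v z)"
  shows "min (lambda_min A) (lambda_min S) * g1 s * (x \<bullet> x + z \<bullet> z) \<le> form x z"
    and "form x z \<le> max (lambda_max A) (lambda_max S) * g2 s * (x \<bullet> x + z \<bullet> z)"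
proof -
  have symA: "symmetric_mat A" and symS: "symmetric_mat S"
    using A S by (auto simp: spd_def spsd_def)
  have posA: "0 \<le> x \<bullet> (A *v x)" for x
    using A by (cases "x = 0") (auto simp: spd_def less_imp_le)
  have posS: "0 \<le> x \<bullet> (S *v x)" for x
    using S by (simp add: spsd_def)
  note inv = spd_invertible[OF A]
  define u where "u = matrix_inv A *v (transpose E *v z)"
  define N where "N = (x + u) \<bullet> (x + u) + z \<bullet> z"
  have form: "form x z = (x + u) \<bullet> (A *v (x + u)) + z \<bullet> (S *v z)"
    using schur_complement_square[OF symA inv, of x E z F] by (simp only: form_def u_def S_def)
  have shear: "g1 s * (x \<bullet> x + z \<bullet> z) \<le> N" "N \<le> g2 s * (x \<bullet> x + z \<bullet> z)"
    using shear_bounds[of s u z x] shear_norm_le[OF symA inv, where E = E]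
    by (simp_all only: s_def u_def N_def)
  let ?a = "min (lambda_min A) (lambda_min S)"
  have "0 \<le> ?a"
    using eigenvalue_nonneg[OF posA lambda_min_attained[OF symA]]
      eigenvalue_nonneg[OF posS lambda_min_attained[OF symS]] by simp
  then have "?a * g1 s * (x \<bullet> x + z \<bullet> z) \<le> ?a * N"
    using shear(1) by (simp add: mult_left_mono mult.assoc)
  also have "\<dots> \<le> lambda_min A * ((x + u) \<bullet> (x + u)) + lambda_min S * (z \<bullet> z)"
    unfolding N_def distrib_left by (intro add_mono mult_right_mono) auto
  also have "\<dots> \<le> form x z"
    unfolding form by (intro add_mono lambda_min_le_rayleigh symA symS)
  finally show "?a * g1 s * (x \<bullet> x + z \<bullet> z) \<le> form x z" .
  let ?b = "max (lambda_max A) (lambda_max S)"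
  have "0 \<le> ?b"
    using lambda_max_nonneg[OF symA posA] by simp
  have "form x z \<le> lambda_max A * ((x + u) \<bullet> (x + u)) + lambda_max S * (z \<bullet> z)"
    unfolding form by (intro add_mono rayleigh_le_lambda_max symA symS)
  also have "\<dots> \<le> ?b * N"
    unfolding N_def distrib_left by (intro add_mono mult_right_mono) auto
  also have "\<dots> \<le> ?b * g2 s * (x \<bullet> x + z \<bullet> z)"
    using shear(2) \<open>0 \<le> ?b\<close> by (simp add: mult_left_mono mult.assoc)
  finally show "form x z \<le> ?b * g2 s * (x \<bullet> x + z \<bullet> z)" .
qed

text \<open>
  With \<open>b = B\<^sup>T y\<close> and \<open>c = C y\<close> the eigenvalue gives \<open>|b|\<^sup>2 + |c|\<^sup>2 \<le> r\<^sup>2 |y|\<^sup>2\<close>. Expanding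
  \<open>|r x - b|\<^sup>2 + |r z + c|\<^sup>2 \<ge> 0\<close> is Cauchy-Schwarz and the inequality of the means in one step,
  at the price of dividing by \<open>r\<close>; for \<open>r = 0\<close> both \<open>b\<close> and \<open>c\<close> vanish.
\<close>

lemma skew_form_bound:
  fixes B :: "real^'n^'m" and C :: "real^'m^'l"
  defines "r \<equiv> sqrt (lambda_max (B ** transpose B + transpose C ** C))"
  shows "2 * \<bar>x \<bullet> (transpose B *v y) - z \<bullet> (C *v y)\<bar> \<le> r * (x \<bullet> x + z \<bullet> z + y \<bullet> y)"
proof -
  let ?G = "B ** transpose B + transpose C ** C"
  let ?b = "transpose B *v y" and ?c = "C *v y"
  have "transpose (X + Y) = transpose X + transpose Y" for X Y :: "real^'m^'m"
    by (simp add: transpose_def vec_eq_iff)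
  then have sym: "symmetric_mat ?G"
    by (simp add: symmetric_mat_def matrix_transpose_mul)
  have form: "y \<bullet> (?G *v y) = (transpose B *v y) \<bullet> (transpose B *v y) + (C *v y) \<bullet> (C *v y)" for y
  proof -
    have "y \<bullet> (?G *v y) = y \<bullet> (B *v (transpose B *v y)) + y \<bullet> (transpose C *v (C *v y))"
      by (simp only: matrix_vector_mult_add_rdistrib matrix_vector_mul_assoc inner_add_right)
    also have "y \<bullet> (B *v (transpose B *v y)) = (transpose B *v y) \<bullet> (transpose B *v y)"
      by (metis inner_transpose_mult inner_commute)
    finally show ?thesis by (simp only: inner_transpose_mult)
  qed
  have "0 \<le> lambda_max ?G"
    by (rule lambda_max_nonneg[OF sym]) (simp only: form inner_ge_zero add_nonneg_nonneg)
  then have r: "0 \<le> r" "r\<^sup>2 = lambda_max ?G" by (auto simp: r_def)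
  have bc: "?b \<bullet> ?b + ?c \<bullet> ?c \<le> r\<^sup>2 * (y \<bullet> y)"
    using rayleigh_le_lambda_max[OF sym, of y] by (simp only: form r)
  have key: "2 * (x \<bullet> ?b - z \<bullet> ?c) \<le> r * (x \<bullet> x + z \<bullet> z + y \<bullet> y)" for x z
  proof (cases "r = 0")
    case True
    then have "?b \<bullet> ?b + ?c \<bullet> ?c \<le> 0"
      using bc by (simp del: transpose_matrix_vector)
    then have "?b \<bullet> ?b = 0" "?c \<bullet> ?c = 0"
      using inner_ge_zero[of ?b] inner_ge_zero[of ?c] by linarith+
    then have "?b = 0" "?c = 0" by (simp_all only: inner_eq_zero_iff)
    with True show ?thesis by (simp del: transpose_matrix_vector)
  next
    case False
    have "0 \<le> (r *\<^sub>R x - ?b) \<bullet> (r *\<^sub>R x - ?b) + (r *\<^sub>R z + ?c) \<bullet> (r *\<^sub>R z + ?c)"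
      by (intro add_nonneg_nonneg inner_ge_zero)
    also have "\<dots> = r\<^sup>2 * (x \<bullet> x + z \<bullet> z) + (?b \<bullet> ?b + ?c \<bullet> ?c) - r * (2 * (x \<bullet> ?b - z \<bullet> ?c))"
      by (simp add: inner_simps inner_commute power2_eq_square algebra_simps del: transpose_matrix_vector)
    also have "\<dots> \<le> r * (r * (x \<bullet> x + z \<bullet> z + y \<bullet> y) - 2 * (x \<bullet> ?b - z \<bullet> ?c))"
      using bc by (simp add: power2_eq_square algebra_simps del: transpose_matrix_vector)
    finally show ?thesis
      using r(1) False by (simp add: zero_le_mult_iff del: transpose_matrix_vector)
  qed
  show ?thesis
    using key[of x z] key[of "- x" "- z"] by (simp add: abs_if del: transpose_matrix_vector)
qed

theorem theorem3p8:
  fixes A :: "real^'n^'n" and B :: "real^'n^'m" and C :: "real^'m^'l"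
    and D :: "real^'m^'m" and E :: "real^'n^'l" and F :: "real^'l^'l"
    and K :: "real^('n + 'm + 'l)^('n + 'm + 'l)"
    and S :: "real^'l^'l" and s :: real and k :: complex
  defines "K \<equiv> block3 A     (transpose B) (transpose E)
                     (- B) D             (transpose C)
                     E     (- C)         F"
    and "S \<equiv> F - E ** matrix_inv A ** transpose E"
    and "s \<equiv> lambda_max (E ** (matrix_inv A ** matrix_inv A) ** transpose E)"
  assumes "spd A" and "symmetric_mat D" and "spsd S"
    and "k \<in> eigenvalues (map_matrix complex_of_real K)"
  shows "Re k \<ge> Min {lambda_min A, lambda_min S, lambda_min D / g1 s} * g1 s \<and>
         Re k \<le> Max {lambda_max A, lambda_max S, lambda_max D / g2 s} * g2 s \<and>
         \<bar>Im k\<bar> \<le> sqrt (lambda_max (B ** transpose B + transpose C ** C))"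
proof -
  define m where "m = Min {lambda_min A, lambda_min S, lambda_min D / g1 s}"
  define M where "M = Max {lambda_max A, lambda_max S, lambda_max D / g2 s}"
  define r where "r = sqrt (lambda_max (B ** transpose B + transpose C ** C))"
  have symA: "symmetric_mat A" and symS: "symmetric_mat S"
    using assms by (auto simp: spd_def spsd_def)
  note inv = spd_invertible[OF \<open>spd A\<close>]
  have "0 \<le> s" unfolding s_def by (rule shear_norm_le(1)[OF symA inv])
  note g = g1_g2_facts(3,4)[OF this]
  obtain p q :: "real^('n + 'm + 'l)" where pq: "0 < p \<bullet> p + q \<bullet> q"
    and re: "p \<bullet> (K *v p) + q \<bullet> (K *v q) = Re k * (p \<bullet> p + q \<bullet> q)"
    and im: "p \<bullet> (K *v q) - q \<bullet> (K *v p) = Im k * (p \<bullet> p + q \<bullet> q)"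
    using complex_eigenvalue_real_forms[OF assms(7)] by blast
  \<comment> \<open>The last two terms cancel when \<open>v = w\<close>; for the skew part they are all
    that matters, since the terms before them are symmetric in \<open>v\<close> and \<open>w\<close>.\<close>
  have bilinear: "v \<bullet> (K *v w) =
      part1 v \<bullet> (A *v part1 w) + part1 v \<bullet> (transpose E *v part3 w)
      + part3 v \<bullet> (E *v part1 w) + part3 v \<bullet> (F *v part3 w)
      + part2 v \<bullet> (D *v part2 w)
      + (part1 v \<bullet> (transpose B *v part2 w) - part3 v \<bullet> (C *v part2 w))
      - (part1 w \<bullet> (transpose B *v part2 v) - part3 w \<bullet> (C *v part2 v))" for v w
    using inner_transpose_mult[of "part1 w" B "part2 v"] inner_transpose_mult[of "part2 v" C "part3 w"]
    by (simp add: inner_parts[of v] K_def block3_mult_parts inner_add_right inner_diff_right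
        uminus_matrix_vector_mult inner_commute del: transpose_matrix_vector)
  have quadratic: "m * g1 s * (v \<bullet> v) \<le> v \<bullet> (K *v v)" "v \<bullet> (K *v v) \<le> M * g2 s * (v \<bullet> v)" for v
  proof -
    let ?x = "part1 v" and ?y = "part2 v" and ?z = "part3 v"
    let ?f = "?x \<bullet> (A *v ?x) + ?x \<bullet> (transpose E *v ?z) + ?z \<bullet> (E *v ?x) + ?z \<bullet> (F *v ?z)"
    have form: "v \<bullet> (K *v v) = ?f + ?y \<bullet> (D *v ?y)"
      unfolding bilinear by simp
    have vv: "v \<bullet> v = (?x \<bullet> ?x + ?z \<bullet> ?z) + ?y \<bullet> ?y"
      by (simp add: inner_parts)
    have "m \<le> min (lambda_min A) (lambda_min S)" "m \<le> lambda_min D / g1 s"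
      by (auto simp: m_def)
    then have mg: "m * g1 s \<le> min (lambda_min A) (lambda_min S) * g1 s" "m * g1 s \<le> lambda_min D"
      using g(1) by (auto simp: pos_le_divide_eq intro: mult_right_mono)
    have "m * g1 s * (v \<bullet> v) \<le> min (lambda_min A) (lambda_min S) * g1 s * (?x \<bullet> ?x + ?z \<bullet> ?z)
        + lambda_min D * (?y \<bullet> ?y)"
      unfolding vv distrib_left[of _ "?x \<bullet> ?x + ?z \<bullet> ?z"]
      by (intro add_mono mult_right_mono[OF mg(1)] mult_right_mono[OF mg(2)]) auto
    also have "\<dots> \<le> ?f + ?y \<bullet> (D *v ?y)"
      using schur_form_bounds(1)[OF \<open>spd A\<close> \<open>spsd S\<close>[unfolded S_def], of ?x ?z]
        lambda_min_le_rayleigh[OF \<open>symmetric_mat D\<close>, of ?y]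
      by (simp only: S_def s_def add_mono)
    finally show "m * g1 s * (v \<bullet> v) \<le> v \<bullet> (K *v v)" by (simp only: form)
    have "max (lambda_max A) (lambda_max S) \<le> M" "lambda_max D / g2 s \<le> M"
      by (auto simp: M_def)
    then have M: "max (lambda_max A) (lambda_max S) * g2 s \<le> M * g2 s" "lambda_max D \<le> M * g2 s"
      using g(2) by (auto simp: pos_divide_le_eq intro: mult_right_mono)
    have "?f + ?y \<bullet> (D *v ?y) \<le> max (lambda_max A) (lambda_max S) * g2 s * (?x \<bullet> ?x + ?z \<bullet> ?z)
        + lambda_max D * (?y \<bullet> ?y)"
      using schur_form_bounds(2)[OF \<open>spd A\<close> \<open>spsd S\<close>[unfolded S_def], of ?x ?z]
        rayleigh_le_lambda_max[OF \<open>symmetric_mat D\<close>, of ?y]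
      by (simp only: S_def s_def add_mono)
    also have "\<dots> \<le> M * g2 s * (v \<bullet> v)"
      unfolding vv distrib_left[of _ "?x \<bullet> ?x + ?z \<bullet> ?z"]
      by (intro add_mono mult_right_mono[OF M(1)] mult_right_mono[OF M(2)]) auto
    finally show "v \<bullet> (K *v v) \<le> M * g2 s * (v \<bullet> v)" by (simp only: form)
  qed
  have "m * g1 s * (p \<bullet> p + q \<bullet> q) \<le> Re k * (p \<bullet> p + q \<bullet> q)"
    using quadratic(1)[of p] quadratic(1)[of q] unfolding re[symmetric] unfolding distrib_left by linarith
  moreover have "Re k * (p \<bullet> p + q \<bullet> q) \<le> M * g2 s * (p \<bullet> p + q \<bullet> q)"
    using quadratic(2)[of p] quadratic(2)[of q] unfolding re[symmetric] unfolding distrib_left by linarith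
  moreover have "\<bar>Im k\<bar> * (p \<bullet> p + q \<bullet> q) \<le> r * (p \<bullet> p + q \<bullet> q)"
  proof -
    define skew where "skew v w = part1 v \<bullet> (transpose B *v part2 w) - part3 v \<bullet> (C *v part2 w)"
      for v w :: "real^('n + 'm + 'l)"
    \<comment> \<open>Symmetry of \<open>F\<close> is inherited from that of its Schur complement \<open>S\<close>.\<close>
    have FS: "F *v z = S *v z + E *v (matrix_inv A *v (transpose E *v z))" for z
      by (simp only: S_def matrix_vector_mult_diff_rdistrib matrix_vector_mul_assoc matrix_mul_assoc) simp
    have symF: "z \<bullet> (F *v z') = z' \<bullet> (F *v z)" for z z'
      unfolding FS inner_add_right
      using symmetric_mat_inner[OF symS, of z z']
        symmetric_mat_inner[OF symmetric_mat_matrix_inv[OF symA inv], of "transpose E *v z" "transpose E *v z'"]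
      by (metis inner_transpose_mult inner_commute)
    have "Im k * (p \<bullet> p + q \<bullet> q) = 2 * skew p q - 2 * skew q p"
      unfolding im[symmetric] bilinear skew_def
      using symmetric_mat_inner[OF symA, of "part1 p" "part1 q"]
        symmetric_mat_inner[OF \<open>symmetric_mat D\<close>, of "part2 p" "part2 q"]
        symF[of "part3 p" "part3 q"]
        inner_transpose_mult[of "part1 p" E "part3 q"] inner_transpose_mult[of "part1 q" E "part3 p"]
      by (simp add: inner_commute del: transpose_matrix_vector)
    moreover have "2 * \<bar>skew p q\<bar> \<le> r * (part1 p \<bullet> part1 p + part3 p \<bullet> part3 p + part2 q \<bullet> part2 q)"
      and "2 * \<bar>skew q p\<bar> \<le> r * (part1 q \<bullet> part1 q + part3 q \<bullet> part3 q + part2 p \<bullet> part2 p)"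
      unfolding skew_def r_def by (rule skew_form_bound)+
    ultimately have "\<bar>Im k * (p \<bullet> p + q \<bullet> q)\<bar>
        \<le> r * (part1 p \<bullet> part1 p + part3 p \<bullet> part3 p + part2 q \<bullet> part2 q)
          + r * (part1 q \<bullet> part1 q + part3 q \<bullet> part3 q + part2 p \<bullet> part2 p)"
      by linarith
    also have "\<dots> = r * (p \<bullet> p + q \<bullet> q)"
      by (simp add: inner_parts algebra_simps)
    finally show ?thesis using pq by (simp add: abs_mult)
  qed
  ultimately show ?thesis
    using pq by (simp only: m_def M_def r_def mult_le_cancel_right_pos)
qed

end
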